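(* Let $n\ge 3$ with $n\neq 6$, let $b\geq 2$, and let $D(T_n^{(b)})$ be the distance matrix of the graph $T_n^{(b)}$. Then the inverse of $D(T_n^{(b)})$ is given by $$D(T_n^{(b)})^{-1} = -\frac{1}{2} L(T_n^{(b)}) + \frac{1}{2b}J + \frac{1}{2(n-6)b}\mathcal{R}(T_n^{(b)}),$$ where $L(T_n^{(b)})$ is the Laplacian matrix of $T_n^{(b)}$, $J$ is the all-ones matrix of order $b(n-1)+1$, and $\mathcal{R}(T_n^{(b)})$ is the explicit matrix defined in the context.
   Context: Graphs. For $n\ge 3$, $T_n$ is the simple graph on $n$ vertices consisting of $n-2$ triangles with a common base: it has two adjacent base vertices, and $n-2$ non-base vertices, each adjacent to exactly the two base vertices and to no other vertex. (For $n=3$, $T_3=K_3$, with two vertices designated as base vertices.) For $n\ge 3$ and $b\ge 2$, $T_n^{(b)}$ is the graph obtained from $b$ copies of $T_n$ (its blocks) by identifying one non-base vertex from each copy into a single vertex, the central cut vertex. Vertex indexing. The vertices of $T_n^{(b)}$ are $1,\dots,b(n-1)+1$, where $c=b(n-1)+1$ is the central cut vertex, and the $k$-th block ($1\le k\le b$) has vertex set $\{(k-1)(n-1)+i: 1\le i\le n-1\}\cup\{c\}$, with $i=1,2$ giving the two base vertices and $i=3,\dots,n-1$ the non-base vertices other than $c$. All matrices are written with respect to this ordering. Distance and Laplacian matrices. The distance matrix $D(G)=[d_{ij}]$ of a connected graph has $d_{ij}$ equal to the length of a shortest path from $i$ to $j$ for $i\neq j$, and $d_{ii}=0$. The Laplacian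 matrix $L(G)=[l_{ij}]$ has $l_{ii}$ equal to the degree of $i$, $l_{ij}=-1$ if $i\ne j$ are adjacent, and $l_{ij}=0$ otherwise. Notation. $I_m$ is the identity matrix of order $m$, $J_{p\times q}$ is the $p\times q$ all-ones matrix, $J_m=J_{m\times m}$, $\mathbf{1}_m$ is the all-ones column vector of length $m$, and $\mathcal{A}_2=\begin{bmatrix}0&1\\1&0\end{bmatrix}$. The matrix $\mathcal{R}(T_n^{(b)})$. It is the symmetric $(b+1)\times(b+1)$ block matrix of order $b(n-1)+1$ (first $b$ block-rows and block-columns of size $n-1$, last one of size $1$) whose first $b$ diagonal blocks are $\mathcal{R}_1$, whose off-diagonal $(i,j)$ blocks with $1\le i\neq j\le b$ are $\mathcal{R}_2$, whose $(i,b+1)$ blocks are $\mathbf{r}_3$ and $(b+1,i)$ blocks are $\mathbf{r}_3^t$ for $1\le i\le b$, and whose $(b+1,b+1)$ block is the scalar $r$. If $n=3$: $\mathcal{R}_1=-2(b-1)I_2+(b+2)\mathcal{A}_2$, $\mathcal{R}_2=2J_2$, $\mathbf{r}_3=3b\,\mathbf{1}_2$, $r=-6(b-1)^2$. If $n\ge 4$: $$\mathcal{R}_1=\begin{bmatrix}(n-5)(n-2)(b-1)I_2+(n-2)(b-(n-5))\mathcal{A}_2 & -((n-4)b-2)J_{2\times(n-3)}\\ -((n-4)b-2)J_{(n-3)\times 2} & b(n-6)I_{n-3}+(b-(n-5))J_{n-3}\end{bmatrix},$$ $$\mathcal{R}_2=\begin{bmatrix}-(n-5)(n-2)J_2 &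 2J_{2\times(n-3)}\\ 2J_{(n-3)\times 2} & -(n-5)J_{n-3}\end{bmatrix},\qquad \mathbf{r}_3=\begin{bmatrix}(n-6)[(n-4)b-(n-3)]\mathbf{1}_2\\ -b(n-6)\mathbf{1}_{n-3}\end{bmatrix},$$ $$r=-(n-5)(n-6)(b-1)^2.$$ *)

theory Defs
  imports
    Complex_Main
    "Graph_Theory.Graph_Theory"
    "Jordan_Normal_Form.Matrix"
begin

text \<open>
  Simple undirected graphs are symmetric, loop-free pair digraphs (locale
  \<^locale>\<open>pair_graph\<close>).  The vertex set is always \<open>{1..m}\<close>, whereas matrices are indexed
  from 0, so row and column \<open>i\<close> of a matrix of a graph belong to the vertex \<open>i + 1\<close>.
\<close>

text \<open>
  On unreachable pairs the value is arbitrary; the notion is only meant for connected graphs.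
\<close>
definition graph_dist :: "'a pair_pre_digraph \<Rightarrow> 'a \<Rightarrow> 'a \<Rightarrow> nat" where
  "graph_dist G u v =
     (LEAST k. \<exists>p. pre_digraph.apath (with_proj G) u p v \<and> length p = k)"

definition distance_mat :: "nat pair_pre_digraph \<Rightarrow> real mat" where
  "distance_mat G = mat (card (pverts G)) (card (pverts G))
     (\<lambda>(i, j). if i = j then 0 else real (graph_dist G (i + 1) (j + 1)))"

text \<open>Each edge is a pair of opposite arcs, so the degree of a vertex is its out-degree.\<close>
definition laplacian_mat :: "nat pair_pre_digraph \<Rightarrow> real mat" where
  "laplacian_mat G = mat (card (pverts G)) (card (pverts G))
     (\<lambda>(i, j). if i = j then real (out_degree (with_proj G) (i + 1))
               else if (i + 1, j + 1) \<in> parcs G then -1 else 0)"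

text \<open>The base vertices are 1 and 2.\<close>
definition T_graph :: "nat \<Rightarrow> nat pair_pre_digraph" where
  "T_graph n = \<lparr> pverts = {1..n},
     parcs = {(u, v). u \<in> {1..n} \<and> v \<in> {1..n} \<and> u \<noteq> v \<and> (u \<in> {1, 2} \<or> v \<in> {1, 2})} \<rparr>"

text \<open>
  The map from the \<open>k\<close>-th copy of \<open>T_graph n\<close> to the vertices of the glued graph.  It sends the
  non-base vertex \<open>n\<close> of every copy to the central cut vertex \<open>b * (n - 1) + 1\<close>.
\<close>
definition block_embed :: "nat \<Rightarrow> nat \<Rightarrow> nat \<Rightarrow> nat \<Rightarrow> nat" where
  "block_embed n b k i = (if i = n then b * (n - 1) + 1 else (k - 1) * (n - 1) + i)"

definition T_blocks :: "nat \<Rightarrow> nat \<Rightarrow> nat pair_pre_digraph" where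
  "T_blocks n b = \<lparr> pverts = {1..b * (n - 1) + 1},
     parcs = (\<Union>k\<in>{1..b}. map_prod (block_embed n b k) (block_embed n b k) ` parcs (T_graph n)) \<rparr>"

definition J_mat :: "nat \<Rightarrow> nat \<Rightarrow> real mat" where
  "J_mat p q = mat p q (\<lambda>_. 1)"

definition ones_vec :: "nat \<Rightarrow> real vec" where
  "ones_vec m = vec m (\<lambda>_. 1)"

definition A2_mat :: "real mat" where
  "A2_mat = mat_of_rows_list 2 [[0, 1], [1, 0]]"

definition R1_mat :: "nat \<Rightarrow> nat \<Rightarrow> real mat" where
  "R1_mat n b = (let n' = real n; b' = real b in
     if n = 3 then (-2 * (b' - 1)) \<cdot>\<^sub>m 1\<^sub>m 2 + (b' + 2) \<cdot>\<^sub>m A2_mat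
     else four_block_mat
       (((n' - 5) * (n' - 2) * (b' - 1)) \<cdot>\<^sub>m 1\<^sub>m 2 + ((n' - 2) * (b' - (n' - 5))) \<cdot>\<^sub>m A2_mat)
       ((- ((n' - 4) * b' - 2)) \<cdot>\<^sub>m J_mat 2 (n - 3))
       ((- ((n' - 4) * b' - 2)) \<cdot>\<^sub>m J_mat (n - 3) 2)
       ((b' * (n' - 6)) \<cdot>\<^sub>m 1\<^sub>m (n - 3) + (b' - (n' - 5)) \<cdot>\<^sub>m J_mat (n - 3) (n - 3)))"

definition R2_mat :: "nat \<Rightarrow> real mat" where
  "R2_mat n = (let n' = real n in
     if n = 3 then 2 \<cdot>\<^sub>m J_mat 2 2
     else four_block_mat
       ((- ((n' - 5) * (n' - 2))) \<cdot>\<^sub>m J_mat 2 2)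
       (2 \<cdot>\<^sub>m J_mat 2 (n - 3))
       (2 \<cdot>\<^sub>m J_mat (n - 3) 2)
       ((- (n' - 5)) \<cdot>\<^sub>m J_mat (n - 3) (n - 3)))"

definition r3_vec :: "nat \<Rightarrow> nat \<Rightarrow> real vec" where
  "r3_vec n b = (let n' = real n; b' = real b in
     if n = 3 then (3 * b') \<cdot>\<^sub>v ones_vec 2
     else (((n' - 6) * ((n' - 4) * b' - (n' - 3))) \<cdot>\<^sub>v ones_vec 2)
          @\<^sub>v ((- (b' * (n' - 6))) \<cdot>\<^sub>v ones_vec (n - 3)))"

definition r_scalar :: "nat \<Rightarrow> nat \<Rightarrow> real" where
  "r_scalar n b = (let n' = real n; b' = real b in
     if n = 3 then -6 * (b' - 1)\<^sup>2
     else - ((n' - 5) * (n' - 6) * (b' - 1)\<^sup>2))"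

text \<open>
  For an index \<open>i < b * (n - 1)\<close>, \<open>i div (n - 1)\<close> is the block containing \<open>i\<close> and
  \<open>i mod (n - 1)\<close> its position inside that block.
\<close>
definition R_mat :: "nat \<Rightarrow> nat \<Rightarrow> real mat" where
  "R_mat n b = (let s = n - 1; c = b * s in
     mat (c + 1) (c + 1) (\<lambda>(i, j).
       if i < c \<and> j < c then
         (if i div s = j div s then R1_mat n b else R2_mat n) $$ (i mod s, j mod s)
       else if i < c then r3_vec n b $ (i mod s)
       else if j < c then r3_vec n b $ (j mod s)
       else r_scalar n b))"

end

theory Submission
  imports Defs "Jordan_Normal_Form.Determinant"
begin

text \<open>
  Write \<open>D\<close> for the distance matrix.  The three-term formula hides a more transparent one,
  \<open>D\<^sup>-\<^sup>1 = (M - u u\<^sup>t / b) / (2 (n - 6))\<close>, which follows the pattern of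
  Graham, Hoffman and Hosoya for graphs glued at cut vertices: a Laplacian-like matrix \<open>M\<close> whose rows
  and columns sum to zero, corrected by a matrix of rank one.

  For a single block \<open>T\<^sub>n\<close> take the vector \<open>u\<^sub>T\<close> with value \<open>n - 4\<close> on the base vertices and \<open>-1\<close>
  on the others (\<open>tri_weight\<close>), and the symmetric matrix \<open>M\<^sub>T\<close> of \<open>tri_core\<close>.  Direct summation gives
  \<open>D\<^sub>T u\<^sub>T = -2 \<one>\<close>, \<open>\<one>\<^sup>t M\<^sub>T = 0\<close> and \<open>D\<^sub>T M\<^sub>T = 2 (n - 6) I - 2 \<one> u\<^sub>T\<^sup>t\<close>.

  The glued graph inherits these identities.  Let \<open>M\<close> be the sum of the copies of \<open>M\<^sub>T\<close> placed on
  the blocks (\<open>glue\<close>).  Every path from a vertex \<open>i\<close> into a block enters it at one fixed vertex, the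
  retraction of \<open>i\<close> onto the block, so on each block the \<open>i\<close>-th row of \<open>D\<close> is a row of \<open>D\<^sub>T\<close> plus a
  constant (\<open>block_dist_vert\<close>).  The constant is killed by the zero column sums of \<open>M\<^sub>T\<close>, and what
  remains is \<open>D M = 2 (n - 6) I - 2 \<one> u\<^sup>t\<close> (\<open>dist_times_core\<close>), where \<open>u\<close> agrees with \<open>u\<^sub>T\<close> away from
  the centre.  The same decomposition gives \<open>D u = -2 b \<one>\<close> (\<open>dist_times_weight\<close>).  Together,
  \<open>D (M - u u\<^sup>t / b) = 2 (n - 6) I\<close>.

  It remains to identify the two formulas.  The Laplacian of the glued graph is likewise the sum of
  the Laplacians of its blocks, and comparing entries by the type of their row and column (base,
  non-base, central) shows that \<open>R\<close> is exactly \<open>2 (n - 6) b\<close> times what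
  \<open>-L / 2 + J / (2 b)\<close> lacks of this inverse (\<open>R_mat_entry\<close>).
\<close>

section \<open>Recognising a graph distance\<close>

text \<open>
  A function that is 0 at \<open>v\<close>, drops by at most 1 along every arc, and drops by exactly 1 along some
  arc out of every other vertex is the distance to \<open>v\<close>: the second property bounds the length of
  every walk from below, and descending along the arcs of the third one gives a walk of that length.
\<close>
lemma graph_dist_eqI:
  assumes wf: "wf_digraph (with_proj G)"
    and v: "v \<in> pverts G" and fv: "f v = 0"
    and lip: "\<And>w w'. (w, w') \<in> parcs G \<Longrightarrow> f w \<le> f w' + 1"
    and desc: "\<And>w. w \<in> pverts G \<Longrightarrow> w \<noteq> v \<Longrightarrow> \<exists>w'. (w, w') \<in> parcs G \<and> f w = f w' + 1"
    and u: "u \<in> pverts G"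
  shows "graph_dist G u v = f u"
proof -
  interpret wf_digraph "with_proj G" by (rule wf)
  have lower: "f w \<le> length p" if "awalk w p v" for w p
    using that
  proof (induction p arbitrary: w)
    case Nil
    then show ?case using fv by (simp add: awalk_Nil_iff)
  next
    case (Cons e p)
    then have "(w, snd e) \<in> parcs G" "awalk (snd e) p v"
      by (auto simp: awalk_Cons_iff)
    with Cons.IH[of "snd e"] lip[of w "snd e"] show ?case by simp
  qed
  \<comment> \<open>The bound on \<open>f\<close> along the path makes it simple: an arc put in front starts at a vertex where
    \<open>f\<close> is larger than everywhere on the path.\<close>
  have upper: "\<exists>p. apath w p v \<and> length p = f w \<and> (\<forall>x \<in> set (awalk_verts w p). f x \<le> f w)"
    if "w \<in> pverts G" for w
    using that
  proof (induction "f w" arbitrary: w rule: less_induct)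
    case less
    show ?case
    proof (cases "w = v")
      case True
      then show ?thesis using v fv by (intro exI[of _ "[]"]) (simp add: apath_Nil_iff)
    next
      case False
      then obtain w' where w': "(w, w') \<in> parcs G" "f w = f w' + 1"
        using desc less.prems by blast
      moreover have "w' \<in> pverts G"
        using head_in_verts[of "(w, w')"] w'(1) by simp
      ultimately obtain p where p: "apath w' p v" "length p = f w'"
        "\<forall>x \<in> set (awalk_verts w' p). f x \<le> f w'"
        using less.hyps[of w'] by auto
      then have "w \<notin> set (awalk_verts w' p)" using w'(2) by force
      then show ?thesis using p w' by (intro exI[of _ "(w, w') # p"]) (auto simp: apath_Cons_iff)
    qed
  qed
  show ?thesis
    unfolding graph_dist_def
  proof (rule Least_equality)
    show "\<exists>p. apath u p v \<and> length p = f u" using upper[OF u] by blast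
  next
    fix k assume "\<exists>p. apath u p v \<and> length p = k"
    then show "f u \<le> k" using lower by (auto simp: apath_def)
  qed
qed

section \<open>Coordinates on the glued graph\<close>

text \<open>
  Vertices are counted from 0 here, as are matrix indices: \<open>0, \<dots>, n - 1\<close> in a block, with base
  vertices 0 and 1 and gluing vertex \<open>n - 1\<close>, and \<open>0, \<dots>, centre\<close> in the glued graph.
\<close>
locale triangle_blocks =
  fixes n b :: nat
  assumes n3: "3 \<le> n" and b1: "1 \<le> b"
begin

definition centre :: nat where "centre = b * (n - 1)"

definition vert :: "nat \<Rightarrow> nat \<Rightarrow> nat" where
  "vert q a = (if a = n - 1 then centre else q * (n - 1) + a)"

definition in_block :: "nat \<Rightarrow> nat \<Rightarrow> bool" where
  "in_block q i \<longleftrightarrow> i = centre \<or> i div (n - 1) = q"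

definition pos :: "nat \<Rightarrow> nat" where
  "pos i = (if i = centre then n - 1 else i mod (n - 1))"

text \<open>
  The retraction onto block \<open>q\<close>, in coordinates of that block: everything outside is sent to the
  vertex \<open>n - 1\<close>, through which it is attached.
\<close>
definition retr :: "nat \<Rightarrow> nat \<Rightarrow> nat" where
  "retr q i = (if in_block q i then pos i else n - 1)"

lemma vert_noncentral: "q < b \<Longrightarrow> a < n - 1 \<Longrightarrow> q * (n - 1) + a < centre"
proof -
  assume "q < b" "a < n - 1"
  then have "q * (n - 1) + a < Suc q * (n - 1)" by simp
  also have "\<dots> \<le> centre" unfolding centre_def using \<open>q < b\<close> by (intro mult_right_mono) auto
  finally show ?thesis .
qed

lemma vert_le: "q < b \<Longrightarrow> a < n \<Longrightarrow> vert q a \<le> centre"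
  using vert_noncentral[of q a] by (cases "a < n - 1") (auto simp: vert_def)

lemma pos_less: "pos i < n"
proof -
  have "i mod (n - 1) < n - 1" using n3 by simp
  moreover from this have "i mod (n - 1) < n" by linarith
  ultimately show ?thesis using n3 by (simp add: pos_def)
qed

lemma pos_noncentral: "i \<noteq> centre \<Longrightarrow> pos i < n - 1"
  using n3 by (simp add: pos_def)

lemma retr_less: "retr q i < n"
  using n3 pos_less by (simp add: retr_def)

lemma block_index_less: "i \<le> centre \<Longrightarrow> i \<noteq> centre \<Longrightarrow> i div (n - 1) < b"
  using n3 by (simp add: centre_def div_less_iff_less_mult)

lemma in_block_vert: "q < b \<Longrightarrow> a < n \<Longrightarrow> in_block q (vert q a)"
  and pos_vert: "q < b \<Longrightarrow> a < n \<Longrightarrow> pos (vert q a) = a"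
proof -
  assume "q < b" "a < n"
  then have "a = n - 1 \<or> q * (n - 1) + a < centre \<and> a < n - 1"
    using vert_noncentral[of q a] by linarith
  then show "in_block q (vert q a)" "pos (vert q a) = a"
    by (auto simp: vert_def in_block_def pos_def)
qed

lemma vert_pos: "in_block q i \<Longrightarrow> vert q (pos i) = i"
  using pos_noncentral[of i] div_mult_mod_eq[of i "n - 1"]
  by (cases "i = centre") (simp_all only: vert_def pos_def in_block_def, auto)

lemma in_some_block: "i \<le> centre \<Longrightarrow> \<exists>q<b. in_block q i"
  using b1 block_index_less[of i] by (cases "i = centre") (auto simp: in_block_def intro: exI[of _ 0])

lemma sum_block:
  assumes "q < b"
  shows "(\<Sum>k\<le>centre. if in_block q k then f k else 0) = (\<Sum>a<n. f (vert q a))"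
proof -
  have "(\<Sum>k\<le>centre. if in_block q k then f k else 0) = sum f {k \<in> {..centre}. in_block q k}"
    by (rule sum.inter_filter[symmetric]) simp
  also have "\<dots> = (\<Sum>a<n. f (vert q a))"
    by (rule sum.reindex_bij_witness[of _ "vert q" pos])
       (use assms in \<open>auto simp: vert_pos pos_vert in_block_vert vert_le pos_less\<close>)
  finally show ?thesis .
qed

section \<open>Sums of matrices over the blocks\<close>

text \<open>
  The sum over all blocks of the matrix \<open>F\<close> placed on the rows and columns of the block.  The \<open>b\<close>
  copies overlap only in the central diagonal entry, where they add up.
\<close>
definition glue :: "(nat \<Rightarrow> nat \<Rightarrow> real) \<Rightarrow> nat \<Rightarrow> nat \<Rightarrow> real" where
  "glue F i j = (\<Sum>q<b. if in_block q i \<and> in_block q j then F (pos i) (pos j) else 0)"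

text \<open>Multiplication by a glued matrix is thereby reduced to sums over one block.\<close>
lemma sum_mult_glue:
  "(\<Sum>k\<le>centre. f k * glue F k j)
     = (\<Sum>q<b. if in_block q j then \<Sum>a<n. f (vert q a) * F a (pos j) else 0)"
proof -
  have "(\<Sum>k\<le>centre. f k * glue F k j)
      = (\<Sum>q<b. \<Sum>k\<le>centre. if in_block q k \<and> in_block q j then f k * F (pos k) (pos j) else 0)"
    by (subst sum.swap) (auto simp: glue_def sum_distrib_left intro!: sum.cong)
  also have "\<dots> = (\<Sum>q<b. if in_block q j then \<Sum>a<n. f (vert q a) * F a (pos j) else 0)"
  proof (rule sum.cong)
    fix q assume q: "q \<in> {..<b}"
    show "(\<Sum>k\<le>centre. if in_block q k \<and> in_block q j then f k * F (pos k) (pos j) else 0)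
        = (if in_block q j then \<Sum>a<n. f (vert q a) * F a (pos j) else 0)"
      using q sum_block[of q "\<lambda>k. f k * F (pos k) (pos j)"]
      by (auto simp: pos_vert intro!: sum.cong)
  qed simp
  finally show ?thesis .
qed

lemma glue_entry:
  assumes "i \<le> centre" "j \<le> centre"
  shows "glue F i j =
    (if i = centre \<and> j = centre then real b * F (n - 1) (n - 1)
     else if i = centre \<or> j = centre \<or> i div (n - 1) = j div (n - 1) then F (pos i) (pos j)
     else 0)"
proof -
  have "(\<Sum>q<b. if in_block q i \<and> in_block q j then F (pos i) (pos j) else 0)
      = (\<Sum>q<b. if q = k then F (pos i) (pos j) else 0)"
    if "\<And>q. q < b \<Longrightarrow> (in_block q i \<and> in_block q j) = (q = k)" for k
    using that by (intro sum.cong) auto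
  then show ?thesis
    using assms block_index_less[of i] block_index_less[of j] unfolding glue_def
    by (auto simp: in_block_def pos_def sum.delta intro!: sum.neutral)
qed

section \<open>The identities for a single block\<close>

definition tri_dist :: "nat \<Rightarrow> nat \<Rightarrow> nat" where
  "tri_dist a a' = (if a = a' then 0 else if a < 2 \<or> a' < 2 then 1 else 2)"

text \<open>
  For \<open>n \<noteq> 6\<close> this is \<open>2 (n - 6) D\<^sub>T\<^sup>-\<^sup>1 + u\<^sub>T u\<^sub>T\<^sup>t\<close>, where \<open>D\<^sub>T\<close> is the distance matrix of \<open>T\<^sub>n\<close> and
  \<open>u\<^sub>T\<close> is \<open>tri_weight\<close>.  The rank-one term is the one that makes the column sums vanish.
\<close>
definition tri_core :: "nat \<Rightarrow> nat \<Rightarrow> real" where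
  "tri_core a a' = (if a = a' then if a < 2 then 4 else 7 - real n
                    else if a < 2 \<and> a' < 2 then 2 * (real n - 4)
                    else if a < 2 \<or> a' < 2 then - 2 else 1)"

definition tri_weight :: "nat \<Rightarrow> real" where
  "tri_weight a = (if a < 2 then real n - 4 else - 1)"

lemma tri_weight_last: "tri_weight (n - 1) = - 1"
proof -
  have "\<not> n - 1 < 2" using n3 by linarith
  then show ?thesis by (simp add: tri_weight_def)
qed

lemma sum_base_nonbase: "(\<Sum>a<n. f a) = f 0 + f 1 + (\<Sum>a=2..<n. f a)" for f :: "nat \<Rightarrow> real"
proof -
  have "{..<n} = insert 0 (insert 1 {2..<n})" using n3 by auto
  then show ?thesis by simp
qed

lemma sum_tri_weight: "(\<Sum>a<n. tri_weight a) = real n - 6"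
  using n3 by (simp add: sum_base_nonbase tri_weight_def of_nat_diff)

lemma dist_times_weight_tri:
  assumes "i < n"
  shows "(\<Sum>a<n. real (tri_dist i a) * tri_weight a) = - 2"
proof -
  have "(\<Sum>a=2..<n. real (tri_dist i a) * tri_weight a)
      = (\<Sum>a=2..<n. if i < 2 then -1 else if a = i then 0 else - 2)"
    by (rule sum.cong) (auto simp: tri_dist_def tri_weight_def)
  also have "\<dots> = (if i < 2 then 2 - real n else - 2 * (real n - 3))"
    using assms n3 by (auto simp: of_nat_diff sum.remove[of _ i] algebra_simps)
  finally show ?thesis
    using n3 assms by (auto simp: sum_base_nonbase tri_dist_def tri_weight_def)
qed

lemma tri_core_column_sum:
  assumes "j < n"
  shows "(\<Sum>a<n. tri_core a j) = 0"
proof -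
  have "(\<Sum>a=2..<n. tri_core a j)
      = (\<Sum>a=2..<n. if j < 2 then - 2 else if a = j then 7 - real n else 1)"
    by (rule sum.cong) (auto simp: tri_core_def)
  also have "\<dots> = (if j < 2 then - 2 * (real n - 2) else 4)"
    using assms n3 by (auto simp: of_nat_diff sum.remove[of _ j] algebra_simps)
  finally show ?thesis
    using n3 assms by (auto simp: sum_base_nonbase tri_core_def)
qed

text \<open>
  Since the columns of \<open>tri_core\<close> sum to 0, a constant may be subtracted from row \<open>i\<close> of the distance
  matrix.  The value of that row at most non-base vertices, 1 or 2, leaves only the two base
  vertices and, if \<open>i\<close> is not a base vertex, \<open>i\<close> itself.
\<close>
lemma dist_times_core_tri:
  assumes "i < n" "j < n"
  shows "(\<Sum>a<n. real (tri_dist i a) * tri_core a j)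
    = (if i = j then 2 * (real n - 6) else 0) - 2 * tri_weight j"
proof -
  have *: "(\<Sum>a<n. real (tri_dist i a) * tri_core a j)
      = (\<Sum>a<n. if a < 2 then (real (tri_dist i a) - (if i < 2 then 1 else 2)) * tri_core a j else 0)
        - (if i < 2 then 0 else 2 * tri_core i j)" (is "_ = ?r - _")
  proof -
    have "(\<Sum>a<n. real (tri_dist i a) * tri_core a j)
      = (\<Sum>a<n. (if a < 2 then (real (tri_dist i a) - (if i < 2 then 1 else 2)) * tri_core a j else 0)
           + (if i < 2 then 1 else 2) * tri_core a j
           - (if a = i then (if i < 2 then 0 else 2 * tri_core i j) else 0))"
      by (rule sum.cong) (auto simp: tri_dist_def algebra_simps)
    also have "\<dots> = ?r - (if i < 2 then 0 else 2 * tri_core i j)"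
      using assms tri_core_column_sum[of j]
      by (simp add: sum_subtractf sum.distrib flip: sum_distrib_left)
    finally show ?thesis .
  qed
  show ?thesis
    unfolding * using assms n3
    by (auto simp: sum_base_nonbase tri_dist_def tri_core_def tri_weight_def less_2_cases_iff)
qed

section \<open>Lifting the identities to the glued graph\<close>

text \<open>
  A shortest path between different blocks passes through the centre.
\<close>
definition block_dist :: "nat \<Rightarrow> nat \<Rightarrow> nat" where
  "block_dist i k = (if i = centre \<or> k = centre \<or> i div (n - 1) = k div (n - 1)
     then tri_dist (pos i) (pos k)
     else tri_dist (pos i) (n - 1) + tri_dist (n - 1) (pos k))"

lemma block_dist_commute: "block_dist i k = block_dist k i"
proof -
  have comm: "tri_dist a a' = tri_dist a' a" for a a'
    unfolding tri_dist_def by (cases "a = a'") (simp, simp only: disj_commute eq_commute[of a'])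
  show ?thesis
  proof (cases "i = centre \<or> k = centre \<or> i div (n - 1) = k div (n - 1)")
    case True
    moreover from this have "k = centre \<or> i = centre \<or> k div (n - 1) = i div (n - 1)"
      by (elim disjE) simp_all
    ultimately show ?thesis
      unfolding block_dist_def by (simp only: if_True comm[of "pos i" "pos k"])
  next
    case False
    moreover from this have "\<not> (k = centre \<or> i = centre \<or> k div (n - 1) = i div (n - 1))"
      by (intro notI, elim disjE) simp_all
    ultimately show ?thesis
      unfolding block_dist_def
      by (simp only: if_False comm[of "pos i" "n - 1"] comm[of "n - 1" "pos k"] add.commute)
  qed
qed

lemma block_dist_self: "block_dist i i = 0"
  by (simp add: block_dist_def tri_dist_def)

text \<open>
  Seen from \<open>i\<close>, a block looks as it does from the retraction of \<open>i\<close>, up to a constant.  Both the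
  lifting of the block identities and the computation of the graph distance rest on this.
\<close>
lemma block_dist_vert:
  assumes "i \<le> centre" "q < b" "a < n"
  shows "block_dist i (vert q a) = block_dist i (vert q (retr q i)) + tri_dist (retr q i) a"
proof (cases "in_block q i")
  case True
  then have "retr q i = pos i" "vert q (pos i) = i"
    by (simp_all add: retr_def vert_pos)
  moreover have "i = centre \<or> vert q a = centre \<or> i div (n - 1) = vert q a div (n - 1)"
    using True in_block_vert[OF assms(2,3)] unfolding in_block_def by (elim disjE) simp_all
  then have "block_dist i (vert q a) = tri_dist (pos i) a"
    unfolding block_dist_def pos_vert[OF assms(2,3)] by (simp only: if_True)
  ultimately show ?thesis by (simp add: block_dist_self)
next
  case False
  then have i: "i \<noteq> centre" "i div (n - 1) \<noteq> q" "retr q i = n - 1"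
    by (auto simp: in_block_def retr_def)
  have "pos (vert q a) = a" by (rule pos_vert[OF assms(2,3)])
  moreover from this have "vert q a = centre \<longleftrightarrow> a = n - 1"
    by (metis pos_def vert_def)
  moreover have "vert q a \<noteq> centre \<longrightarrow> vert q a div (n - 1) = q"
    using in_block_vert[OF assms(2,3)] by (auto simp: in_block_def)
  moreover have "vert q (n - 1) = centre" "pos centre = n - 1"
    by (simp_all add: vert_def pos_def)
  ultimately show ?thesis
    using i by (cases "a = n - 1") (simp_all add: block_dist_def tri_dist_def)
qed

text \<open>
  At the centre, the contributions \<open>-1\<close> of the \<open>b\<close> blocks add up to \<open>-b\<close>, and a further
  \<open>(b - 1) (n - 6)\<close> is subtracted (see \<open>weight_eq\<close>).  This correction is forced by \<open>D M\<close>: a central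
  vertex is the retraction of \<open>i\<close> onto \<open>b - 1\<close> blocks more than the identity matrix accounts for.
\<close>
definition weight :: "nat \<Rightarrow> real" where
  "weight i = (if i = centre then (real n - 6) - real b * (real n - 5) else tri_weight (pos i))"

lemma retr_eq_pos_iff:
  "in_block q j \<Longrightarrow> in_block q i \<Longrightarrow> retr q i = pos j \<longleftrightarrow> i = j"
  by (metis retr_def vert_pos)

lemma sum_if_ne: "k < b \<Longrightarrow> (\<Sum>q<b. if q = k then x else y) = x + (real b - 1) * y" for x y :: real
  by (simp add: sum.remove[of _ k] of_nat_diff)

text \<open>
  Block by block, \<open>D\<close> acts on \<open>tri_core\<close> as the distance matrix of \<open>T\<^sub>n\<close> does, in the row of the
  retraction of \<open>i\<close>.  For \<open>j\<close> outside the centre only the block of \<open>j\<close> contributes.  For the central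
  column all blocks do, and those that retract \<open>i\<close> to the centre, which are all blocks or all but
  one, contribute the additional term \<open>2 (n - 6)\<close>.
\<close>
lemma dist_times_core:
  assumes "i \<le> centre" "j \<le> centre"
  shows "(\<Sum>k\<le>centre. real (block_dist i k) * glue tri_core k j)
    = (if i = j then 2 * (real n - 6) else 0) - 2 * weight j"
proof -
  have block: "(\<Sum>a<n. real (block_dist i (vert q a)) * tri_core a (pos j))
      = (if retr q i = pos j then 2 * (real n - 6) else 0) - 2 * tri_weight (pos j)" if "q < b" for q
  proof -
    have "(\<Sum>a<n. real (block_dist i (vert q a)) * tri_core a (pos j))
      = (\<Sum>a<n. real (block_dist i (vert q (retr q i))) * tri_core a (pos j)
           + real (tri_dist (retr q i) a) * tri_core a (pos j))"
      using that assms by (intro sum.cong) (simp_all add: block_dist_vert[of i q] algebra_simps)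
    also have "\<dots> = (\<Sum>a<n. real (tri_dist (retr q i) a) * tri_core a (pos j))"
      by (simp add: sum.distrib tri_core_column_sum pos_less flip: sum_distrib_left)
    finally show ?thesis by (simp add: dist_times_core_tri retr_less pos_less)
  qed
  have "(\<Sum>k\<le>centre. real (block_dist i k) * glue tri_core k j)
    = (\<Sum>q<b. if in_block q j
         then (if retr q i = pos j then 2 * (real n - 6) else 0) - 2 * tri_weight (pos j) else 0)"
    unfolding sum_mult_glue by (intro sum.cong) (simp_all add: block)
  also have "\<dots> = (if i = j then 2 * (real n - 6) else 0) - 2 * weight j"
  proof (cases "j = centre")
    case False
    let ?k = "j div (n - 1)"
    have "retr ?k i = pos j \<longleftrightarrow> i = j"
      using False pos_noncentral[of j] retr_eq_pos_iff[of ?k j i]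
      by (cases "in_block ?k i") (auto simp: retr_def in_block_def)
    then have "(\<Sum>q<b. if in_block q j
         then (if retr q i = pos j then 2 * (real n - 6) else 0) - 2 * tri_weight (pos j) else 0)
      = (\<Sum>q<b. if q = ?k then (if i = j then 2 * (real n - 6) else 0) - 2 * tri_weight (pos j) else 0)"
      using False by (intro sum.cong) (auto simp: in_block_def)
    with False block_index_less[of j] assms show ?thesis by (simp add: weight_def)
  next
    case True
    have w: "tri_weight (n - 1) = - 1" by (rule tri_weight_last)
    show ?thesis
    proof (cases "i = centre")
      case True
      with \<open>j = centre\<close> show ?thesis
        by (simp add: retr_def in_block_def pos_def weight_def w[simplified] algebra_simps)
    next
      case False
      have "(\<Sum>q<b. if in_block q j
         then (if retr q i = pos j then 2 * (real n - 6) else 0) - 2 * tri_weight (pos j) else 0)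
        = (\<Sum>q<b. if q = i div (n - 1) then 2 else 2 * (real n - 6) + 2)"
        using True False pos_noncentral[of i]
        by (intro sum.cong) (auto simp: retr_def in_block_def pos_def w[simplified])
      also have "\<dots> = 2 + (real b - 1) * (2 * (real n - 6) + 2)"
        using False block_index_less[of i] assms by (intro sum_if_ne) auto
      finally show ?thesis using True False by (simp add: weight_def algebra_simps)
    qed
  qed
  finally show ?thesis .
qed

lemma weight_eq:
  assumes "k \<le> centre"
  shows "weight k = (\<Sum>q<b. if in_block q k then tri_weight (pos k) else 0)
    - (if k = centre then (real b - 1) * (real n - 6) else 0)"
proof (cases "k = centre")
  case True
  then show ?thesis
    by (simp add: weight_def in_block_def pos_def tri_weight_last[simplified] algebra_simps)
next
  case False
  then have "(\<Sum>q<b. if in_block q k then tri_weight (pos k) else 0)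
      = (\<Sum>q<b. if q = k div (n - 1) then tri_weight (pos k) else 0)"
    by (intro sum.cong) (auto simp: in_block_def)
  with False block_index_less[of k] assms show ?thesis by (simp add: weight_def)
qed

text \<open>
  Each block contributes \<open>-2\<close>, and each of the \<open>b - 1\<close> blocks away from \<open>i\<close> contributes the distance
  from \<open>i\<close> to the centre times the total weight \<open>n - 6\<close> of a block.  The correction of the central
  weight cancels the latter.
\<close>
lemma dist_times_weight:
  assumes "i \<le> centre"
  shows "(\<Sum>k\<le>centre. real (block_dist i k) * weight k) = - 2 * real b"
proof -
  have block: "(\<Sum>a<n. real (block_dist i (vert q a)) * tri_weight a)
      = (if in_block q i then 0 else (real n - 6) * real (block_dist i centre)) - 2" if "q < b" for q
  proof -
    have d: "block_dist i (vert q (retr q i)) = (if in_block q i then 0 else block_dist i centre)"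
    proof (cases "in_block q i")
      case True
      then have "vert q (retr q i) = i" by (simp add: retr_def vert_pos)
      then show ?thesis using True by (simp add: block_dist_self)
    next
      case False
      then have "vert q (retr q i) = centre" by (simp add: retr_def vert_def)
      then show ?thesis using False by (simp only: if_False)
    qed
    have "(\<Sum>a<n. real (block_dist i (vert q a)) * tri_weight a)
      = (\<Sum>a<n. real (block_dist i (vert q (retr q i))) * tri_weight a
           + real (tri_dist (retr q i) a) * tri_weight a)"
      using that assms by (intro sum.cong) (simp_all add: block_dist_vert[of i q] algebra_simps)
    also have "\<dots> = (real n - 6) * real (block_dist i (vert q (retr q i))) - 2"
      by (simp add: sum.distrib dist_times_weight_tri sum_tri_weight retr_less
          flip: sum_distrib_left)
    finally show ?thesis
      using d by simp
  qed
  have away: "(\<Sum>q<b. if in_block q i then 0 else (real n - 6) * real (block_dist i centre))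
      = (real b - 1) * ((real n - 6) * real (block_dist i centre))"
  proof (cases "i = centre")
    case False
    then have "in_block q i \<longleftrightarrow> q = i div (n - 1)" for q
      by (auto simp: in_block_def)
    moreover have "i div (n - 1) < b" using False block_index_less assms by blast
    ultimately show ?thesis by (simp add: sum_if_ne)
  qed (simp add: in_block_def block_dist_def tri_dist_def)
  have "(\<Sum>k\<le>centre. real (block_dist i k) * weight k)
      = (\<Sum>k\<le>centre. \<Sum>q<b. if in_block q k then real (block_dist i k) * tri_weight (pos k) else 0)
        - (\<Sum>k\<le>centre. if k = centre then (real b - 1) * ((real n - 6) * real (block_dist i centre)) else 0)"
    unfolding sum_subtractf[symmetric]
  proof (rule sum.cong)
    fix k assume "k \<in> {..centre}"
    then have "real (block_dist i k) * weight k
      = real (block_dist i k) * (\<Sum>q<b. if in_block q k then tri_weight (pos k) else 0)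
        - real (block_dist i k) * (if k = centre then (real b - 1) * (real n - 6) else 0)"
      by (simp add: weight_eq right_diff_distrib)
    also have "real (block_dist i k) * (\<Sum>q<b. if in_block q k then tri_weight (pos k) else 0)
        = (\<Sum>q<b. if in_block q k then real (block_dist i k) * tri_weight (pos k) else 0)"
      unfolding sum_distrib_left by (intro sum.cong) auto
    finally show "real (block_dist i k) * weight k
      = (\<Sum>q<b. if in_block q k then real (block_dist i k) * tri_weight (pos k) else 0)
        - (if k = centre then (real b - 1) * ((real n - 6) * real (block_dist i centre)) else 0)"
      by simp
  qed simp
  also have "(\<Sum>k\<le>centre. \<Sum>q<b. if in_block q k then real (block_dist i k) * tri_weight (pos k) else 0)
      = (\<Sum>q<b. \<Sum>a<n. real (block_dist i (vert q a)) * tri_weight a)"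
    by (subst sum.swap) (auto simp: sum_block pos_vert intro!: sum.cong)
  also have "\<dots> = (real b - 1) * ((real n - 6) * real (block_dist i centre)) - 2 * real b"
    by (simp add: block sum_subtractf away)
  finally show ?thesis by simp
qed

definition inv_entry :: "nat \<Rightarrow> nat \<Rightarrow> real" where
  "inv_entry i j = (glue tri_core i j - weight i * weight j / real b) / (2 * (real n - 6))"

lemma dist_times_inv_entry:
  assumes "n \<noteq> 6" "i \<le> centre" "j \<le> centre"
  shows "(\<Sum>k\<le>centre. real (block_dist i k) * inv_entry k j) = (if i = j then 1 else 0)"
proof -
  have "(\<Sum>k\<le>centre. real (block_dist i k) * inv_entry k j)
    = ((\<Sum>k\<le>centre. real (block_dist i k) * glue tri_core k j)
       - (\<Sum>k\<le>centre. real (block_dist i k) * weight k) * weight j / real b) / (2 * (real n - 6))"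
    by (simp add: inv_entry_def sum_divide_distrib sum_distrib_right sum_subtractf diff_divide_distrib
        right_diff_distrib mult.assoc)
  also have "\<dots> = (if i = j then 1 else 0)"
    using assms b1 by (simp add: dist_times_core dist_times_weight)
  finally show ?thesis .
qed

section \<open>The distance matrix and the Laplacian of the glued graph\<close>

lemma pverts_T_blocks: "pverts (T_blocks n b) = {1..centre + 1}"
  by (simp add: T_blocks_def centre_def)

lemma parcs_T_blocks:
  "parcs (T_blocks n b) = {(vert q a + 1, vert q a' + 1) |q a a'.
     q < b \<and> a < n \<and> a' < n \<and> a \<noteq> a' \<and> (a < 2 \<or> a' < 2)}"
proof -
  have e: "block_embed n b (q + 1) (a + 1) = vert q a + 1" if "a < n" for q a
    using that n3 by (auto simp: block_embed_def vert_def centre_def)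
  have B: "{1..b} = (\<lambda>q. q + 1) ` {..<b}"
    by (metis Suc_eq_plus1 atLeast1_atMost_eq_remove0 image_Suc_lessThan image_cong)
  have P: "parcs (T_graph n) = map_prod (\<lambda>a. a + 1) (\<lambda>a. a + 1) `
      {(a, a'). a < n \<and> a' < n \<and> a \<noteq> a' \<and> (a < 2 \<or> a' < 2)}" (is "?A = ?f ` ?B")
  proof (intro equalityI subsetI)
    fix x assume "x \<in> ?A"
    then show "x \<in> ?f ` ?B"
      by (intro image_eqI[of _ _ "map_prod (\<lambda>a. a - 1) (\<lambda>a. a - 1) x"])
         (auto simp: T_graph_def)
  qed (auto simp: T_graph_def)
  have "parcs (T_blocks n b) = (\<Union>q<b. (\<lambda>(a, a').
      (block_embed n b (q + 1) (a + 1), block_embed n b (q + 1) (a' + 1))) `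
      {(a, a'). a < n \<and> a' < n \<and> a \<noteq> a' \<and> (a < 2 \<or> a' < 2)})"
    unfolding T_blocks_def B P by (simp add: image_image map_prod_def case_prod_unfold)
  also have "\<dots> = (\<Union>q<b. (\<lambda>(a, a'). (vert q a + 1, vert q a' + 1)) `
      {(a, a'). a < n \<and> a' < n \<and> a \<noteq> a' \<and> (a < 2 \<or> a' < 2)})"
    by (intro SUP_cong image_cong refl) (auto simp: e[simplified])
  finally show ?thesis by (auto simp: image_iff)
qed

lemma wf_T_blocks: "wf_digraph (with_proj (T_blocks n b))"
  by unfold_locales (use vert_le in \<open>auto simp: pverts_T_blocks parcs_T_blocks\<close>)

lemma arc_iff:
  assumes "i \<le> centre" "j \<le> centre"
  shows "(i + 1, j + 1) \<in> parcs (T_blocks n b) \<longleftrightarrow>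
    (\<exists>q<b. in_block q i \<and> in_block q j \<and> pos i \<noteq> pos j \<and> (pos i < 2 \<or> pos j < 2))"
proof
  assume "(i + 1, j + 1) \<in> parcs (T_blocks n b)"
  then show "\<exists>q<b. in_block q i \<and> in_block q j \<and> pos i \<noteq> pos j \<and> (pos i < 2 \<or> pos j < 2)"
    by (auto simp: parcs_T_blocks in_block_vert pos_vert)
next
  assume "\<exists>q<b. in_block q i \<and> in_block q j \<and> pos i \<noteq> pos j \<and> (pos i < 2 \<or> pos j < 2)"
  then obtain q where q: "q < b" "in_block q i" "in_block q j" "pos i \<noteq> pos j"
    "pos i < 2 \<or> pos j < 2" by blast
  then have "vert q (pos i) = i" "vert q (pos j) = j" by (simp_all add: vert_pos)
  then show "(i + 1, j + 1) \<in> parcs (T_blocks n b)"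
    unfolding parcs_T_blocks mem_Collect_eq
    by (intro exI[of _ q] exI[of _ "pos i"] exI[of _ "pos j"]) (use q pos_less in auto)
qed

text \<open>
  By \<open>block_dist_vert\<close>, the change of the distance along an arc takes place in one block, where it is
  the change of a distance in \<open>T\<^sub>n\<close>.
\<close>
lemma graph_dist_T_blocks:
  assumes "i \<le> centre" "k \<le> centre"
  shows "graph_dist (T_blocks n b) (i + 1) (k + 1) = block_dist i k"
proof -
  have "graph_dist (T_blocks n b) (i + 1) (k + 1) = block_dist k (i + 1 - 1)"
  proof (rule graph_dist_eqI[where f = "\<lambda>w. block_dist k (w - 1)"])
    fix w w' assume "(w, w') \<in> parcs (T_blocks n b)"
    then obtain q a a' where *: "w = vert q a + 1" "w' = vert q a' + 1" "q < b" "a < n" "a' < n"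
      "a \<noteq> a'" "a < 2 \<or> a' < 2" unfolding parcs_T_blocks by blast
    have "tri_dist (retr q k) a \<le> tri_dist (retr q k) a' + 1"
      using * by (auto simp: tri_dist_def)
    with * show "block_dist k (w - 1) \<le> block_dist k (w' - 1) + 1"
      using block_dist_vert[of k q a] block_dist_vert[of k q a'] assms by simp
  next
    fix w assume "w \<in> pverts (T_blocks n b)" "w \<noteq> k + 1"
    then obtain j where j: "w = j + 1" "j \<le> centre" "j \<noteq> k"
      by (cases w) (auto simp: pverts_T_blocks)
    \<comment> \<open>A block of \<open>j\<close> in which one can move towards \<open>k\<close>: for the centre it has to be the block of \<open>k\<close>.\<close>
    obtain q where q: "q < b" "in_block q j" "retr q k \<noteq> pos j"
    proof (cases "j = centre")
      case True
      obtain q where "q < b" "in_block q k" using in_some_block assms by blast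
      moreover from True have "in_block q j" by (simp add: in_block_def)
      ultimately show thesis using that retr_eq_pos_iff j(3) by blast
    next
      case False
      obtain q where q: "q < b" "in_block q j" using in_some_block j(2) by blast
      have "retr q k \<noteq> pos j"
      proof (cases "in_block q k")
        case True
        then show ?thesis using retr_eq_pos_iff q(2) j(3) by blast
      next
        case False
        then show ?thesis using pos_noncentral[OF \<open>j \<noteq> centre\<close>] by (simp add: retr_def)
      qed
      with q that show thesis by blast
    qed
    let ?a = "pos j" and ?r = "retr q k"
    have vj: "vert q ?a = j" using q by (simp add: vert_pos)
    \<comment> \<open>Two non-base vertices are joined through the base vertex 0.\<close>
    define a' where "a' = (if ?a < 2 \<or> ?r < 2 then ?r else 0)"
    have a': "a' < n" "?a \<noteq> a'" "?a < 2 \<or> a' < 2" "tri_dist ?r ?a = tri_dist ?r a' + 1"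
      using q(3) n3 retr_less[of q k] by (auto simp: a'_def tri_dist_def)
    have "(vert q ?a + 1, vert q a' + 1) \<in> parcs (T_blocks n b)"
      unfolding parcs_T_blocks using a' q(1) pos_less by blast
    moreover have "block_dist k (vert q ?a) = block_dist k (vert q a') + 1"
      using block_dist_vert[OF assms(2) q(1) pos_less, of j]
        block_dist_vert[OF assms(2) q(1) a'(1)] a'(4)
      by linarith
    ultimately have "(w, vert q a' + 1) \<in> parcs (T_blocks n b) \<and>
        block_dist k (w - 1) = block_dist k (vert q a' + 1 - 1) + 1"
      unfolding vj j(1) by simp
    then show "\<exists>w'. (w, w') \<in> parcs (T_blocks n b) \<and> block_dist k (w - 1) = block_dist k (w' - 1) + 1"
      by blast
  qed (use assms in \<open>simp_all add: wf_T_blocks pverts_T_blocks block_dist_self\<close>)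
  then show ?thesis by (simp add: block_dist_commute)
qed

lemma distance_mat_T_blocks:
  "distance_mat (T_blocks n b) = mat (centre + 1) (centre + 1) (\<lambda>(i, j). real (block_dist i j))"
proof -
  have "(if i = j then 0 else real (graph_dist (T_blocks n b) (i + 1) (j + 1))) = real (block_dist i j)"
    if "i < centre + 1" "j < centre + 1" for i j
  proof -
    have "i \<le> centre" "j \<le> centre" using that by linarith+
    then have "graph_dist (T_blocks n b) (i + 1) (j + 1) = block_dist i j"
      by (rule graph_dist_T_blocks)
    then show ?thesis by (simp add: block_dist_self)
  qed
  then show ?thesis
    unfolding distance_mat_def pverts_T_blocks card_atLeastAtMost
    by (intro cong_mat) simp_all
qed

definition tri_adj :: "nat \<Rightarrow> nat \<Rightarrow> real" where
  "tri_adj a a' = of_bool (a \<noteq> a' \<and> (a < 2 \<or> a' < 2))"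

definition tri_lapl :: "nat \<Rightarrow> nat \<Rightarrow> real" where
  "tri_lapl a a' = (if a = a' then if a < 2 then real n - 1 else 2
                    else if a < 2 \<or> a' < 2 then - 1 else 0)"

lemma pos_inj: "in_block q i \<Longrightarrow> in_block q j \<Longrightarrow> pos i = pos j \<longleftrightarrow> i = j"
  by (metis vert_pos)

text \<open>
  Different blocks have no arc in common, so the sum over the blocks is an indicator.  In the central
  diagonal entry, \<open>b\<close> zeros are added.
\<close>
lemma arc_eq_glue:
  assumes "i \<le> centre" "j \<le> centre"
  shows "of_bool ((i + 1, j + 1) \<in> parcs (T_blocks n b)) = glue tri_adj i j"
proof (cases "\<exists>q<b. in_block q i \<and> in_block q j")
  case True
  then obtain q where q: "q < b" "in_block q i" "in_block q j" by blast
  have arc: "of_bool ((i + 1, j + 1) \<in> parcs (T_blocks n b)) = tri_adj (pos i) (pos j)"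
    using q unfolding arc_iff[OF assms] tri_adj_def by (intro arg_cong[of _ _ of_bool]) blast
  have block: "i = centre \<or> j = centre \<or> i div (n - 1) = j div (n - 1)"
    using q(2,3) unfolding in_block_def by (elim disjE) simp_all
  show ?thesis
  proof (cases "i = centre \<and> j = centre")
    case True
    then show ?thesis unfolding arc glue_entry[OF assms] by (simp add: tri_adj_def)
  next
    case False
    then show ?thesis unfolding arc glue_entry[OF assms] by (simp only: block if_False if_True)
  qed
next
  case False
  then have "glue tri_adj i j = 0"
    unfolding glue_def by (intro sum.neutral) auto
  moreover have "(i + 1, j + 1) \<notin> parcs (T_blocks n b)"
    unfolding arc_iff[OF assms] using False by blast
  ultimately show ?thesis by simp
qed

lemma tri_degree:
  assumes "a < n"
  shows "(\<Sum>a'<n. tri_adj a' a) = (if a < 2 then real n - 1 else 2)"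
proof -
  have "(\<Sum>a'=2..<n. tri_adj a' a) = (\<Sum>a'=2..<n. if a < 2 then 1 else 0)"
    by (rule sum.cong) (auto simp: tri_adj_def)
  with assms n3 show ?thesis
    by (auto simp: sum_base_nonbase tri_adj_def of_nat_diff less_2_cases_iff)
qed

lemma out_degree_T_blocks:
  assumes "i \<le> centre"
  shows "real (out_degree (with_proj (T_blocks n b)) (i + 1)) = glue tri_lapl i i"
proof -
  have "out_arcs (with_proj (T_blocks n b)) (i + 1)
      = (\<lambda>j. (i + 1, j + 1)) ` {j \<in> {..centre}. (i + 1, j + 1) \<in> parcs (T_blocks n b)}"
  proof -
    have "\<exists>j\<le>centre. w = j + 1" if "(v, w) \<in> parcs (T_blocks n b)" for v w
      using that vert_le by (auto simp: parcs_T_blocks)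
    then show ?thesis by (auto simp: out_arcs_def) blast
  qed
  then have "real (out_degree (with_proj (T_blocks n b)) (i + 1))
      = (\<Sum>j\<le>centre. of_bool ((i + 1, j + 1) \<in> parcs (T_blocks n b)))"
    by (simp add: out_degree_def card_image inj_on_def Int_def)
  also have "\<dots> = (\<Sum>j\<le>centre. 1 * glue tri_adj j i)"
  proof (rule sum.cong)
    fix j assume "j \<in> {..centre}"
    then have "of_bool ((i + 1, j + 1) \<in> parcs (T_blocks n b)) = glue tri_adj i j"
      using assms by (intro arc_eq_glue) auto
    also have "\<dots> = glue tri_adj j i"
      unfolding glue_def by (intro sum.cong) (auto simp: tri_adj_def)
    finally show "of_bool ((i + 1, j + 1) \<in> parcs (T_blocks n b)) = 1 * glue tri_adj j i"
      by simp
  qed simp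
  also have "\<dots> = glue tri_lapl i i"
    unfolding sum_mult_glue
    by (simp add: glue_def tri_degree pos_less tri_lapl_def cong: if_cong)
  finally show ?thesis .
qed

lemma laplacian_mat_T_blocks:
  "laplacian_mat (T_blocks n b) = mat (centre + 1) (centre + 1) (\<lambda>(i, j). glue tri_lapl i j)"
proof -
  have "(if (i + 1, j + 1) \<in> parcs (T_blocks n b) then - 1 else 0) = glue tri_lapl i j"
    if "i \<le> centre" "j \<le> centre" "i \<noteq> j" for i j
  proof -
    have "(if (i + 1, j + 1) \<in> parcs (T_blocks n b) then - 1 else 0) = - glue tri_adj i j"
      unfolding arc_eq_glue[OF that(1,2), symmetric] by simp
    also have "\<dots> = glue tri_lapl i j"
      unfolding glue_def sum_negf[symmetric]
      by (intro sum.cong) (use that in \<open>auto simp: tri_adj_def tri_lapl_def pos_inj\<close>)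
    finally show ?thesis .
  qed
  then have "(if i = j then real (out_degree (with_proj (T_blocks n b)) (i + 1))
      else if (i + 1, j + 1) \<in> parcs (T_blocks n b) then - 1 else 0) = glue tri_lapl i j"
    if "i < centre + 1" "j < centre + 1" for i j
    using that out_degree_T_blocks[of i] by (cases "i = j") simp_all
  then show ?thesis
    unfolding laplacian_mat_def pverts_T_blocks card_atLeastAtMost
    by (intro cong_mat) simp_all
qed

section \<open>The matrix \<open>R\<close>\<close>

text \<open>
  In entries, the case \<open>n = 3\<close> is the general formula for a block without non-base vertices other
  than the centre.
\<close>
lemma R1_mat_entry:
  assumes "p < n - 1" "p' < n - 1"
  shows "R1_mat n b $$ (p, p') =
    (if p < 2 \<and> p' < 2 then
       if p = p' then (real n - 5) * (real n - 2) * (real b - 1)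
       else (real n - 2) * (real b - (real n - 5))
     else if p < 2 \<or> p' < 2 then 2 - (real n - 4) * real b
     else (if p = p' then real b * (real n - 6) else 0) + (real b - (real n - 5)))"
proof (cases "n = 3")
  case True
  with assms have "p = 0 \<or> p = 1" "p' = 0 \<or> p' = 1" by auto
  with True show ?thesis
    by (auto simp: R1_mat_def Let_def A2_mat_def mat_of_rows_list_def)
next
  case False
  with assms n3 show ?thesis
    by (auto simp: R1_mat_def Let_def A2_mat_def mat_of_rows_list_def J_mat_def less_2_cases_iff)
qed

lemma R2_mat_entry:
  assumes "p < n - 1" "p' < n - 1"
  shows "R2_mat n $$ (p, p') =
    (if p < 2 \<and> p' < 2 then - ((real n - 5) * (real n - 2))
     else if p < 2 \<or> p' < 2 then 2
     else - (real n - 5))"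
  using assms n3 by (cases "n = 3") (auto simp: R2_mat_def Let_def J_mat_def)

lemma r3_vec_entry:
  assumes "p < n - 1"
  shows "r3_vec n b $ p =
    (if p < 2 then (real n - 6) * ((real n - 4) * real b - (real n - 3))
     else - (real b * (real n - 6)))"
  using assms n3 by (cases "n = 3") (auto simp: r3_vec_def Let_def ones_vec_def)

lemma r_scalar_eq: "r_scalar n b = - ((real n - 5) * (real n - 6) * (real b - 1)\<^sup>2)"
  by (simp add: r_scalar_def Let_def)

text \<open>
  This is \<open>2 (n - 6) b\<close> times the equation between the two formulas for the inverse, solved for \<open>R\<close>.
  For each type of row and column it is a polynomial identity in \<open>n\<close> and \<open>b\<close>.
\<close>
lemma R_mat_entry:
  assumes "i \<le> centre" "j \<le> centre"
  shows "R_mat n b $$ (i, j) = real b * (glue tri_core i j + (real n - 6) * glue tri_lapl i j)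
    - weight i * weight j - (real n - 6)"
proof -
  have not2: "\<not> n - 1 < 2" using n3 by linarith
  have pos_centre: "pos centre = n - 1" by (simp add: pos_def)
  have R: "R_mat n b $$ (i, j) =
      (if i < centre \<and> j < centre then
         (if i div (n - 1) = j div (n - 1) then R1_mat n b else R2_mat n) $$ (pos i, pos j)
       else if i < centre then r3_vec n b $ pos i
       else if j < centre then r3_vec n b $ pos j
       else r_scalar n b)"
    unfolding R_mat_def Let_def centre_def[symmetric] using assms by (auto simp: pos_def)
  consider (both) "i = centre" "j = centre" | (left) "i = centre" "j \<noteq> centre"
    | (right) "i \<noteq> centre" "j = centre" | (none) "i \<noteq> centre" "j \<noteq> centre" by blast
  then show ?thesis
  proof cases
    case both
    then show ?thesis unfolding R glue_entry[OF assms] r_scalar_eq using not2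
      by (simp add: tri_core_def tri_lapl_def weight_def algebra_simps power2_eq_square)
  next
    case left
    then show ?thesis unfolding R glue_entry[OF assms]
      using assms not2 pos_noncentral[of j]
      by (simp add: r3_vec_entry pos_centre tri_core_def tri_lapl_def weight_def tri_weight_def
          algebra_simps)
  next
    case right
    then show ?thesis unfolding R glue_entry[OF assms]
      using assms not2 pos_noncentral[of i]
      by (simp add: r3_vec_entry pos_centre tri_core_def tri_lapl_def weight_def tri_weight_def
          algebra_simps)
  next
    case none
    then show ?thesis unfolding R glue_entry[OF assms]
      using assms pos_noncentral[of i] pos_noncentral[of j]
      by (simp add: R1_mat_entry R2_mat_entry tri_core_def tri_lapl_def weight_def tri_weight_def
          algebra_simps)
  qed
qed

lemma formula_eq_inv_entry:
  assumes "n \<noteq> 6" "i \<le> centre" "j \<le> centre"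
  shows "- 1 / 2 * glue tri_lapl i j + 1 / (2 * real b)
    + 1 / (2 * (real n - 6) * real b) * R_mat n b $$ (i, j) = inv_entry i j"
proof -
  have "- 1 / 2 * L + 1 / (2 * \<beta>) + 1 / (2 * \<nu> * \<beta>) * (\<beta> * (C + \<nu> * L) - W - \<nu>)
    = (C - W / \<beta>) / (2 * \<nu>)" if "\<nu> \<noteq> 0" "\<beta> \<noteq> 0" for C L W \<beta> \<nu> :: real
    using that by (simp add: field_simps)
  moreover have "real n - 6 \<noteq> 0" "real b \<noteq> 0" using assms(1) b1 by auto
  ultimately show ?thesis
    unfolding R_mat_entry[OF assms(2,3)] inv_entry_def by blast
qed

end

section \<open>The inverse of the distance matrix\<close>

theorem theorem3p2:
  fixes n b :: nat
  assumes "n \<ge> 3" and "n \<noteq> 6" and "b \<ge> 2"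
  defines "m \<equiv> b * (n - 1) + 1"
  defines "D \<equiv> distance_mat (T_blocks n b)"
  defines "X \<equiv> (- 1 / 2) \<cdot>\<^sub>m laplacian_mat (T_blocks n b)
                + (1 / (2 * real b)) \<cdot>\<^sub>m J_mat m m
                + (1 / (2 * (real n - 6) * real b)) \<cdot>\<^sub>m R_mat n b"
  shows "inverts_mat D X \<and> inverts_mat X D"
proof -
  interpret triangle_blocks n b
    using assms by unfold_locales auto
  have m': "m = centre + 1" by (simp add: m_def centre_def)
  have D: "D = mat m m (\<lambda>(i, j). real (block_dist i j))"
    by (simp add: D_def m' distance_mat_T_blocks)
  have X: "X = mat m m (\<lambda>(i, j). inv_entry i j)"
  proof (rule eq_matI)
    fix i j assume "i < dim_row (mat m m (\<lambda>(i, j). inv_entry i j))"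
      "j < dim_col (mat m m (\<lambda>(i, j). inv_entry i j))"
    then have ij: "i \<le> centre" "j \<le> centre" by (auto simp: m')
    have "dim_row (R_mat n b) = m" "dim_col (R_mat n b) = m"
      by (simp_all add: R_mat_def Let_def m' centre_def)
    with ij show "X $$ (i, j) = mat m m (\<lambda>(i, j). inv_entry i j) $$ (i, j)"
      using formula_eq_inv_entry[OF assms(2) ij]
      by (simp add: X_def laplacian_mat_T_blocks J_mat_def m')
  qed (simp_all add: X_def R_mat_def Let_def m' centre_def)
  have m: "{0..<m} = {..centre}" by (auto simp: m')
  \<comment> \<open>One product suffices, as a one-sided inverse of a square matrix over a field is two-sided.\<close>
  have "D * X = 1\<^sub>m m"
  proof (rule eq_matI)
    fix i j assume "i < dim_row (1\<^sub>m m :: real mat)" "j < dim_col (1\<^sub>m m :: real mat)"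
    then have "i < m" "j < m" "i \<le> centre" "j \<le> centre" by (auto simp: m')
    then show "(D * X) $$ (i, j) = 1\<^sub>m m $$ (i, j)"
      using dist_times_inv_entry[OF assms(2), of i j, folded m] by (simp add: D X scalar_prod_def)
  qed (simp_all add: D X)
  moreover have "D \<in> carrier_mat m m" "X \<in> carrier_mat m m" by (simp_all add: D X)
  ultimately show ?thesis
    using mat_mult_left_right_inverse[of D m X] by (auto simp: inverts_mat_def)
qed

end
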